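(* Let $n>0$ be an integer. Then the graph $G_{n,n,2}$ contains a (directed) Hamiltonian cycle.
   Context: For positive integers $n,m$, the graph $G_{n,m,2}$ (an augmented directed grid graph on a two-holed torus) is defined as follows. Its vertices are the $4nm$ cells $(i,c)$ of a grid with $2n$ rows $0\le i<2n$ (row $0$ on top) and $2m$ columns $0\le c<2m$ (column $0$ leftmost). The bijection $u$ ("up") on cells is $u(i,c)=(i-1,c)$ if $i\ge 1$, and $u(0,c)=(2n-1,(c+m)\bmod 2m)$. The bijection $r$ ("right") on cells is $r(i,c)=(i,c+1)$ if $c<2m-1$, and $r(i,2m-1)=((i+n)\bmod 2n,0)$. The directed edges are $(\alpha,u\alpha)$ and $(\alpha,r\alpha)$ for every cell $\alpha$. A Hamiltonian cycle is a directed cycle visiting every vertex exactly once. *)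

theory Defs
  imports "Graph_Theory.Graph_Theory"
begin

text \<open>
  A cell is a pair (row, column), with row 0 on top and column 0 leftmost. The maps below are
  only meaningful on \<open>cells n m\<close>, where there are \<open>2 * n\<close> rows and \<open>2 * m\<close> columns.
\<close>

definition cells :: "nat \<Rightarrow> nat \<Rightarrow> (nat \<times> nat) set" where
  "cells n m = {0..<2 * n} \<times> {0..<2 * m}"

fun up :: "nat \<Rightarrow> nat \<Rightarrow> nat \<times> nat \<Rightarrow> nat \<times> nat" where
  "up n m (i, c) = (if i \<ge> 1 then (i - 1, c) else (2 * n - 1, (c + m) mod (2 * m)))"

fun right :: "nat \<Rightarrow> nat \<Rightarrow> nat \<times> nat \<Rightarrow> nat \<times> nat" where
  "right n m (i, c) = (if c < 2 * m - 1 then (i, c + 1) else ((i + n) mod (2 * n), 0))"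

text \<open>
  Arcs are pairs of cells, so where \<open>up\<close> and \<open>right\<close> agree there is a single arc; this does not
  affect which vertex sequences are cycles.
\<close>

definition grid_graph :: "nat \<Rightarrow> nat \<Rightarrow> (nat \<times> nat) pair_pre_digraph" where
  "grid_graph n m =
     \<lparr> pverts = cells n m,
       parcs = {(a, up n m a) | a. a \<in> cells n m} \<union> {(a, right n m a) | a. a \<in> cells n m} \<rparr>"

text \<open>
  A cycle is a nonempty closed arc walk whose arc tails are pairwise distinct (see
  \<open>distinct_tails_of_cycle\<close>), so the second conjunct says that it visits every vertex
  exactly once.
\<close>

definition (in pre_digraph) hamiltonian_cycle :: "'b awalk \<Rightarrow> bool" where
  "hamiltonian_cycle p \<longleftrightarrow> cycle p \<and> tail G ` set p = verts G"

lemma (in pre_digraph) distinct_tails_of_cycle: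
  assumes "cycle p"
  shows "distinct (map (tail G) p)"
proof -
  obtain u where u: "awalk u p u" "distinct (tl (awalk_verts u p))" "p \<noteq> []"
    using assms unfolding cycle_def by blast
  then obtain e es where p: "p = e # es" by (cases p) auto
  have cas: "cas u p u" using u(1) by (simp add: awalk_def)
  have last: "cas x q y \<Longrightarrow> last (awalk_verts x q) = y" for x q y
    by (induction q arbitrary: x) auto
  have "tail G e = u" using cas p by simp
  moreover have "awalk_verts (head G e) es = map (tail G) es @ [u]"
  proof -
    have "last (awalk_verts (head G e) es) = u" using cas p last by simp
    then show ?thesis by (cases "es = []") (auto simp: awalk_verts_conv)
  qed
  ultimately show ?thesis using u(2) p by auto
qed

lemma bij_betw_up:
  assumes "n > 0" "m > 0"
  shows "bij_betw (up n m) (cells n m) (cells n m)"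
proof (rule bij_betwI')
  fix x y assume x: "x \<in> cells n m" and y: "y \<in> cells n m"
  have eq: "(c + m) mod (2 * m) = (if c < m then c + m else c - m)" if "c < 2 * m" for c
    using that by (auto simp: mod_if)
  show "(up n m x = up n m y) = (x = y)"
    using x y by (cases x; cases y) (auto simp: cells_def eq split: if_splits)
next
  fix x assume "x \<in> cells n m"
  then show "up n m x \<in> cells n m" by (cases x) (auto simp: cells_def)
next
  fix y assume y: "y \<in> cells n m"
  obtain i c where [simp]: "y = (i, c)" by (cases y)
  show "\<exists>x\<in>cells n m. y = up n m x"
  proof (cases "i = 2 * n - 1")
    case True
    have "(c + m) mod (2 * m) < 2 * m" using assms by simp
    moreover have "((c + m) mod (2 * m) + m) mod (2 * m) = c"
      using y by (simp add: cells_def mod_add_left_eq add.assoc flip: mult_2)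
    ultimately show ?thesis using True assms
      by (intro bexI[of _ "(0, (c + m) mod (2 * m))"]) (auto simp: cells_def)
  next
    case False
    then show ?thesis using y by (intro bexI[of _ "(i + 1, c)"]) (auto simp: cells_def)
  qed
qed

lemma bij_betw_right:
  assumes "n > 0" "m > 0"
  shows "bij_betw (right n m) (cells n m) (cells n m)"
proof (rule bij_betwI')
  fix x y assume x: "x \<in> cells n m" and y: "y \<in> cells n m"
  have eq: "(i + n) mod (2 * n) = (if i < n then i + n else i - n)" if "i < 2 * n" for i
    using that by (auto simp: mod_if)
  show "(right n m x = right n m y) = (x = y)"
    using x y by (cases x; cases y) (auto simp: cells_def eq split: if_splits)
next
  fix x assume "x \<in> cells n m"
  then show "right n m x \<in> cells n m" by (cases x) (auto simp: cells_def)
next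
  fix y assume y: "y \<in> cells n m"
  obtain i c where [simp]: "y = (i, c)" by (cases y)
  show "\<exists>x\<in>cells n m. y = right n m x"
  proof (cases "c = 0")
    case True
    have "(i + n) mod (2 * n) < 2 * n" using assms by simp
    moreover have "((i + n) mod (2 * n) + n) mod (2 * n) = i"
      using y by (simp add: cells_def mod_add_left_eq add.assoc flip: mult_2)
    ultimately show ?thesis using True assms
      by (intro bexI[of _ "((i + n) mod (2 * n), 2 * m - 1)"]) (auto simp: cells_def)
  next
    case False
    then show ?thesis using y by (intro bexI[of _ "(i, c - 1)"]) (auto simp: cells_def)
  qed
qed

lemma pair_fin_digraph_grid_graph: "pair_fin_digraph (grid_graph n m)"
proof -
  have fin: "finite (cells n m)" by (simp add: cells_def)
  have up: "up n m a \<in> cells n m" and right: "right n m a \<in> cells n m"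
    if "a \<in> cells n m" for a
    using that by (cases a; auto simp: cells_def)+
  show ?thesis
    by unfold_locales
      (auto simp: grid_graph_def fin up right finite_image_set
        simp del: up.simps right.simps split_paired_Ex)
qed

end

theory Submission
  imports Defs
begin

text \<open>
  Following \<open>up\<close> alone splits the grid into the cycles that alternate between the columns
  \<open>k\<close> and \<open>n + k\<close>. Turning right at the \<open>n\<close> cells \<open>(k, n + k)\<close> splices these cycles together:
  the path climbs column \<open>n + k\<close> from the bottom to row \<open>k\<close>, moves right, completes the part of
  column \<open>n + k + 1\<close> above its diagonal cell, climbs all of column \<open>k + 1\<close>, and arrives at the
  bottom of column \<open>n + k + 1\<close>. From the last diagonal cell it goes to the bottom of column \<open>0\<close>,
  and from there back to the bottom of column \<open>n\<close>.
\<close>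

text \<open>Since \<open>a\<close> lies in its own orbit, iterating \<open>f\<close> returns to it
  after a first time \<open>N\<close>. The iterates before \<open>N\<close> are distinct and exhaust
  the orbit, so they are the tails of the required closed walk.\<close>

lemma hamiltonian_cycle_of_orbit:
  assumes a: "a \<in> pverts G" and orbit: "orbit f a = pverts G"
    and arc: "\<And>x. x \<in> pverts G \<Longrightarrow> (x, f x) \<in> parcs G"
  shows "\<exists>p. pre_digraph.hamiltonian_cycle (with_proj G) p"
proof -
  interpret pre_digraph "with_proj G" .
  define w where "w k = ((f ^^ k) a, (f ^^ Suc k) a)" for k
  define N where "N = funpow_dist1 f a a"
  define p where "p = map w [0..<N]"
  have self: "a \<in> orbit f a" using a orbit by simp
  have N: "N > 0" and closes: "(f ^^ N) a = a"
    using funpow_dist1_prop[OF self] by (simp_all add: N_def)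
  have verts: "(\<lambda>k. (f ^^ k) a) ` {0..<N} = pverts G"
    using orbit_conv_funpow_dist1[OF self] orbit by (simp add: N_def)
  have inj: "inj_on (\<lambda>k. (f ^^ k) a) {0..<N}"
    using inj_on_funpow_dist1[OF self] by (simp add: N_def)
  have iter: "(f ^^ k) a \<in> pverts G" for k
    using funpow_in_orbit[OF self] orbit by simp
  have cas: "cas ((f ^^ i) a) (map w [i..<j]) ((f ^^ j) a)" if "i \<le> j" for i j
    using that by (induction rule: inc_induct) (auto simp: w_def upt_conv_Cons)
  have tails: "map fst p = map (\<lambda>k. (f ^^ k) a) [0..<N]"
    by (simp add: p_def w_def)
  have walk: "awalk a p a"
    unfolding awalk_def
    using cas[of 0 N] closes a arc iter by (auto simp: p_def w_def)
  have "tl (awalk_verts a p) = map snd p"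
    using walk N awalk_verts_conv'[of a p a] by (auto simp: awalk_def p_def)
  moreover have "distinct (map snd p)"
  proof -
    \<comment> \<open>\<open>cycle\<close> asks for distinct heads. Each head is the next tail,
      cyclically by \<open>closes\<close>, so distinctness of the iterates carries over.\<close>
    have "map snd p = rotate1 (map fst p)"
    proof (rule nth_equalityI)
      show "length (map snd p) = length (rotate1 (map fst p))" by simp
      fix i assume "i < length (map snd p)"
      then have i: "i < N" by (simp add: p_def)
      show "map snd p ! i = rotate1 (map fst p) ! i"
      proof (cases "Suc i = N")
        case True
        then have "f ((f ^^ i) a) = a" using closes by auto
        then show ?thesis using i True unfolding tails
          by (simp add: nth_rotate1 p_def w_def closes)
      next
        case False
        then have "Suc i < N" using i by simp
        then show ?thesis using i unfolding tails
          by (simp add: nth_rotate1 p_def w_def)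
      qed
    qed
    moreover have "distinct (map fst p)"
      using inj by (simp add: tails distinct_map)
    ultimately show ?thesis by simp
  qed
  ultimately have "cycle p"
    unfolding cycle_def using walk N by (auto simp: p_def)
  moreover have "fst ` set p = pverts G"
    using arg_cong[OF tails, of set] verts by simp
  ultimately show ?thesis
    unfolding hamiltonian_cycle_def by auto
qed

definition diagonal_turn :: "nat \<Rightarrow> nat \<times> nat \<Rightarrow> nat \<times> nat" where
  "diagonal_turn n x = (if snd x = fst x + n then right n n x else up n n x)"

lemma diagonal_turn_in_cells:
  "x \<in> cells n n \<Longrightarrow> diagonal_turn n x \<in> cells n n"
  by (cases x) (auto simp: diagonal_turn_def cells_def)

lemma add_half_mod:
  fixes c m :: nat
  assumes "c < 2 * m"
  shows "(c + m) mod (2 * m) = (if c < m then c + m else c - m)"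
  using assms by (auto simp: mod_if)

text \<open>\<open>diagonal_turn\<close> is \<open>up\<close> except at the diagonal cell in row
  \<open>c - n\<close>. The side condition puts that cell either strictly below the start or no
  lower than the target, where the climb has already ended. Columns \<open>c < n\<close> have no
  such cell.\<close>

lemma climb:
  assumes closed: "\<forall>x\<in>S. diagonal_turn n x \<in> S"
    and start: "(k, c) \<in> S" and "i \<le> k" "k + n < c \<or> c \<le> i + n"
  shows "(i, c) \<in> S"
  using assms(3,4)
proof (induction rule: inc_induct)
  case base
  then show ?case using start by simp
next
  case (step j)
  then have "(Suc j, c) \<in> S" by auto
  from bspec[OF closed this] step show ?case
    by (auto simp: diagonal_turn_def)
qed

lemma orbit_diagonal_turn:
  assumes n: "n > 0"
  shows "orbit (diagonal_turn n) (0, 0) = cells n n"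
proof
  have cells_00: "(0, 0) \<in> cells n n" using n by (simp add: cells_def)
  show "orbit (diagonal_turn n) (0, 0) \<subseteq> cells n n"
  proof
    fix x assume "x \<in> orbit (diagonal_turn n) (0, 0)"
    then show "x \<in> cells n n"
      by induction (use n in \<open>simp_all add: diagonal_turn_in_cells cells_00\<close>)
  qed
next
  define S where "S = orbit (diagonal_turn n) (0, 0)"
  have closed: "\<forall>x\<in>S. diagonal_turn n x \<in> S"
    unfolding S_def by (blast intro: orbit.step)
  have step: "y \<in> S" if "x \<in> S" "diagonal_turn n x = y" for x y
    using bspec[OF closed that(1)] that(2) by simp
  note climb = climb[OF closed]
  \<comment> \<open>\<open>orbit\<close> begins with the image of its base point, so
    \<open>(0, 0)\<close> itself is only recovered by the return to column \<open>0\<close> in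
    \<open>zero\<close>.\<close>
  have "diagonal_turn n (0, 0) \<in> S" by (simp add: S_def orbit.base)
  then have first: "(2 * n - 1, n) \<in> S" using n by (simp add: diagonal_turn_def)
  \<comment> \<open>The rest of column \<open>n + k\<close> follows from its bottom cell by
    \<open>climb\<close>. Column \<open>0\<close> is excluded because it is entered last.\<close>
  have bottom: "(2 * n - 1, n + k) \<in> S \<and> (\<forall>i<k. (i, n + k) \<in> S) \<and> (0 < k \<longrightarrow> (\<forall>i<2*n. (i, k) \<in> S))"
    if "k < n" for k
    using that
  proof (induction k)
    case 0
    show ?case using first by simp
  next
    case (Suc k)
    have "(k, n + k) \<in> S" by (rule climb[of "2 * n - 1"]) (use Suc in auto)
    then have turn: "(k, n + Suc k) \<in> S"
      by (rule step) (use Suc in \<open>auto simp: diagonal_turn_def\<close>)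
    have above: "(i, n + Suc k) \<in> S" if "i < Suc k" for i
      by (rule climb[OF turn]) (use that in auto)
    have "(2 * n - 1, Suc k) \<in> S"
      by (rule step[OF above[of 0]]) (use Suc add_half_mod[of "n + Suc k" n] in \<open>auto simp: diagonal_turn_def\<close>)
    then have left: "(i, Suc k) \<in> S" if "i < 2 * n" for i
      by (rule climb) (use that Suc in auto)
    have "(2 * n - 1, n + Suc k) \<in> S"
      by (rule step[OF left[of 0]]) (use Suc in \<open>auto simp: diagonal_turn_def\<close>)
    with above left show ?case by blast
  qed
  have below: "(i, n + k) \<in> S" if "k \<le> i" "i < 2 * n" "k < n" for i k
    by (rule climb[of "2 * n - 1"]) (use bottom[of k] that in auto)
  have "(2 * n - 1, 0) \<in> S"
    \<comment> \<open>Turning right at the last diagonal cell \<open>(n - 1, 2 * n - 1)\<close>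
      wraps around to column \<open>0\<close> and shifts the row by \<open>n\<close>, to
      \<open>2 * n - 1\<close>.\<close>
    by (rule step[OF below[of "n - 1" "n - 1"]]) (use n add_half_mod[of "n - 1" n] in \<open>auto simp: diagonal_turn_def\<close>)
  then have zero: "(i, 0) \<in> S" if "i < 2 * n" for i
    by (rule climb) (use that n in auto)
  have "(i, c) \<in> S" if i: "i < 2 * n" and c: "c < 2 * n" for i c
  proof (cases "c < n")
    case True
    then show ?thesis using zero bottom[of c] i by (cases "c = 0") auto
  next
    case False
    then obtain k where k: "c = n + k" by (metis le_add_diff_inverse not_less)
    then show ?thesis using below[of k i] bottom[of k] i c by (cases "i < k") auto
  qed
  then show "cells n n \<subseteq> orbit (diagonal_turn n) (0, 0)"
    by (auto simp: cells_def S_def)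
qed

theorem proposition14:
  fixes n :: nat
  assumes "n > 0"
  shows "\<exists>p. pre_digraph.hamiltonian_cycle (with_proj (grid_graph n n)) p"
proof (rule hamiltonian_cycle_of_orbit)
  show "(0, 0) \<in> pverts (grid_graph n n)"
    using assms by (simp add: grid_graph_def cells_def)
  show "orbit (diagonal_turn n) (0, 0) = pverts (grid_graph n n)"
    using orbit_diagonal_turn[OF assms] by (simp add: grid_graph_def)
  show "(x, diagonal_turn n x) \<in> parcs (grid_graph n n)"
    if "x \<in> pverts (grid_graph n n)" for x
    using that by (auto simp: grid_graph_def diagonal_turn_def
      simp del: up.simps right.simps split_paired_Ex)
qed

end
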